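(* Let $n\ge 1$ be an integer. The system of ordinary differential equations $$\dot{x}=x^2-xy+n-1,\qquad \dot{y}=xy-nx^2$$ (corresponding to the Bryant soliton, i.e. the rotationally symmetric steady gradient Ricci soliton, on $\mathbb{R}^{n+1}$) passes the strong Painlevé test if and only if $n=1$, $n=4$, or $n=9$.
   Context: The independent variable $t$ is taken to be complex and the dot denotes $d/dt$. A system of $d$ first-order autonomous ODEs in $d$ unknown functions passes the strong Painlevé test if it admits a family of meromorphic solutions with a movable singularity depending on a maximal number of free parameters. That is: there is a family of solutions given, near a point $t_0\in\mathbb{C}$, by Laurent series in $t-t_0$ with finitely many negative powers and with leading exponents fixed throughout the family, convergent in a punctured neighborhood of $t_0$, with at least one component having a pole at $t_0$, and the family depends on $d$ free parameters. The position $t_0$ of the singularity counts as one free parameter. The remaining free parameters are coefficients of the expansions that can be chosen arbitrarily (a leading coefficient being required to be nonzero) and independently when the series are substituted into the system and the coefficients are solved for recursively; all other coefficients are determined by these, up to finitely many choices. Here $d=2$. *)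

theory Defs
  imports "HOL-Complex_Analysis.Complex_Analysis"
begin

text \<open>
  A system of \<open>d\<close> first-order autonomous equations is given by its right-hand side
  \<open>f :: complex^'d \<Rightarrow> complex^'d\<close> with \<open>d = CARD('d)\<close>. A candidate solution near \<open>t0\<close> is a vector
  \<open>X\<close> of Laurent series in the local variable \<open>t - t0\<close>. Note that \<^const>\<open>eval_fls\<close> is the sum of the
  series wherever \<open>0 < norm (t - t0) < fls_conv_radius (X $ i)\<close>.
\<close>

definition laurent_solution ::
  "(complex^'d \<Rightarrow> complex^'d) \<Rightarrow> complex \<Rightarrow> (complex fls)^'d \<Rightarrow> bool" where
  "laurent_solution f t0 X \<longleftrightarrow>
     (\<forall>i. fls_conv_radius (X $ i) > 0) \<and>
     (\<forall>\<^sub>F t in at t0. \<forall>i.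
        ((\<lambda>s. eval_fls (X $ i) (s - t0)) has_field_derivative
           f (\<chi> j. eval_fls (X $ j) (t - t0)) $ i) (at t))"

text \<open>
  The family of all convergent Laurent solutions at \<open>t0\<close> with prescribed leading exponents \<open>k\<close> and
  with leading coefficient vector in \<open>A\<close>. The set \<open>A\<close> selects the branch (or branches) of solutions
  of the leading-order equations that the family belongs to: distinct branches may share their
  leading exponents and yet have different numbers of free coefficients.
\<close>

definition laurent_family ::
  "(complex^'d \<Rightarrow> complex^'d) \<Rightarrow> complex \<Rightarrow> ('d \<Rightarrow> int) \<Rightarrow> (complex^'d) set
     \<Rightarrow> ((complex fls)^'d) set" where
  "laurent_family f t0 k A =
     {X. laurent_solution f t0 X \<and>
         (\<forall>i. X $ i \<noteq> 0 \<and> fls_subdegree (X $ i) = k i) \<and>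
         (\<chi> i. fls_nth (X $ i) (k i)) \<in> A}"

text \<open>
  \<open>P\<close> is the set of positions of the free coefficients: \<open>(i, m) \<in> P\<close> means that the coefficient of
  \<open>(t - t0)^m\<close> in the \<open>i\<close>-th component is free. Together with \<open>t0\<close> these are \<open>d\<close> parameters. They
  are arbitrary and independent (the fibre over every admissible \<open>t0\<close>, \<open>v\<close> is nonempty) and they
  determine the remaining coefficients up to finitely many choices (the fibre is finite).
\<close>

definition strong_Painleve_test :: "(complex^'d \<Rightarrow> complex^'d) \<Rightarrow> bool" where
  "strong_Painleve_test f \<longleftrightarrow>
     (\<exists>(k :: 'd \<Rightarrow> int) (A :: (complex^'d) set) (P :: ('d \<times> int) set).
        (\<exists>i. k i < 0) \<and>
        finite P \<and> card P = CARD('d) - 1 \<and> (\<forall>(i, m)\<in>P. k i \<le> m) \<and>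
        (\<forall>t0 (v :: 'd \<times> int \<Rightarrow> complex).
           (\<forall>(i, m)\<in>P. m = k i \<longrightarrow> v (i, m) \<noteq> 0) \<longrightarrow>
           (let S = {X \<in> laurent_family f t0 k A. \<forall>(i, m)\<in>P. fls_nth (X $ i) m = v (i, m)}
            in S \<noteq> {} \<and> finite S)))"

definition bryant_system :: "nat \<Rightarrow> complex^2 \<Rightarrow> complex^2" where
  "bryant_system n u =
     (let x = u $ 1; y = u $ 2
      in vector [x^2 - x * y + of_nat n - 1, x * y - of_nat n * x^2])"

end

theory Submission
  imports Defs
begin

text \<open>
  Write \<open>N\<close> for \<open>n\<close> as a complex number. Comparing lowest-order terms shows that a Laurent solution
  with a pole has a simple pole in both components, \<open>x \<sim> a / \<tau>\<close> and \<open>y \<sim> b / \<tau>\<close> with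
  \<open>\<tau> = t - t0\<close>, where \<open>b = a + 1\<close> and \<open>N a\<^sup>2 = (a + 1)\<^sup>2\<close>; so \<open>a\<close> takes at most two values
  (\<open>leading_exponents\<close>, \<open>bryant_series_recurrence\<close>). Put \<open>x = f / \<tau>\<close>, \<open>y = g / \<tau>\<close> with power series
  \<open>f\<close>, \<open>g\<close>. At order \<open>r > 0\<close> the system becomes two linear equations for the \<open>r\<close>-th coefficients of
  \<open>f\<close> and \<open>g\<close>, with right-hand sides built from earlier coefficients. Their determinant is
  \<open>(r + 1) (r - 2 - 2 a)\<close>, so apart from \<open>t0\<close> (the root \<open>r = -1\<close>) a parameter can enter only at the
  resonance \<open>r = 2 + 2 a\<close>.

  If the test is passed, one coefficient takes every nonzero value, so the family at a fixed \<open>t0\<close> is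
  infinite. Without a resonance at a positive integer each of the finitely many values of \<open>a\<close>
  determines the solution, and the family is finite. So \<open>2 + 2 a\<close> is a positive integer, and
  \<open>N a\<^sup>2 = (a + 1)\<^sup>2\<close> becomes an equation in integers: with \<open>j = 2 a\<close>, \<open>n j\<^sup>2 = (j + 2)\<^sup>2\<close>. Hence \<open>j\<close> divides
  \<open>2\<close>, that is \<open>j \<in> {-1, 1, 2}\<close> and \<open>n \<in> {1, 9, 4}\<close> (\<open>resonance_values\<close>).

  Conversely, for \<open>n = 1, 4, 9\<close> the branches \<open>a = -1/2, 1, 1/2\<close> have resonances at \<open>r = 1, 4, 3\<close>. The
  right-hand sides vanish there because the coefficients before the resonance are sparse, so the
  singular linear system is solvable and the \<open>r\<close>-th coefficient of \<open>f\<close> is free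
  (\<open>bryant_series_exists\<close>, \<open>bryant_series_unique\<close>). The formal solutions converge
  (\<open>bryant_series_converges\<close>): the determinant grows like \<open>r\<^sup>2\<close> and the cofactors like \<open>r\<close>, so the
  recursion gains a factor \<open>1 / r\<close>, which compensates for the length of the convolution on the
  right-hand side and leaves a geometric bound.
\<close>

unbundle fps_syntax
\<comment> \<open>The infix \<open>$\<close> denotes coefficients of power series until the vector components return below.\<close>
unbundle no vec_syntax

section \<open>Leading exponents\<close>

lemma fls_mult_nth_below:
  fixes F G :: "complex fls"
  shows "k < fls_subdegree F + fls_subdegree G \<Longrightarrow> (F * G) $$ k = 0"
proof (cases "F = 0 \<or> G = 0")
  case False
  then show "k < fls_subdegree F + fls_subdegree G \<Longrightarrow> (F * G) $$ k = 0"
    by (intro fls_eq0_below_subdegree) simp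
qed auto

text \<open>
  Balance the lowest-order terms. If \<open>G\<close> alone had a pole, its derivative would have a term that no
  product matches, so \<open>F\<close> has a pole. If the pole of \<open>G\<close> were the stronger one, \<open>F G\<close> would be
  unmatched in the first equation; if it were the weaker one, \<open>N F\<^sup>2\<close> would be unmatched in the second.
  A common order below \<open>-1\<close> would make the two quadratic leading terms vanish, which forces \<open>N = 1\<close> and
  equal leading coefficients; but for \<open>N = 1\<close> the sum \<open>F + G\<close> is constant, whereas its polar part would
  start with twice that coefficient.
\<close>

lemma leading_exponents:
  fixes F G :: "complex fls"
  assumes F: "fls_deriv F = F * F - F * G + fls_const (N - 1)"
    and G: "fls_deriv G = F * G - fls_const N * (F * F)"
    and nz: "F \<noteq> 0" "G \<noteq> 0" "N \<noteq> 0"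
    and pole: "fls_subdegree F < 0 \<or> fls_subdegree G < 0"
  shows "fls_subdegree F = -1" "fls_subdegree G = -1"
proof -
  define p where "p = fls_subdegree F"
  define q where "q = fls_subdegree G"
  define a where "a = F $$ p"
  define b where "b = G $$ q"
  have ab: "a \<noteq> 0" "b \<noteq> 0"
    using nz by (auto simp: a_def b_def p_def q_def)
  have F0: "F $$ k = 0" if "k < p" for k using that by (auto simp: p_def)
  have G0: "G $$ k = 0" if "k < q" for k using that by (auto simp: q_def)
  have FF0: "(F * F) $$ k = 0" if "k < 2 * p" for k
    using that by (intro fls_mult_nth_below) (simp add: p_def)
  have FG0: "(F * G) $$ k = 0" if "k < p + q" for k
    using that by (intro fls_mult_nth_below) (simp add: p_def q_def)
  have FFb: "(F * F) $$ (2 * p) = a * a"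
    using fls_times_base[of F F] by (simp add: a_def p_def)
  have FGb: "(F * G) $$ (p + q) = a * b"
    using fls_times_base[of F G] by (simp add: a_def b_def p_def q_def)
  have eF: "of_int (k + 1) * F $$ (k + 1) = (F * F) $$ k - (F * G) $$ k" if "k < 0" for k
    using arg_cong[OF F, of "\<lambda>H. H $$ k"] that by simp
  have eG: "of_int (k + 1) * G $$ (k + 1) = (F * G) $$ k - N * (F * F) $$ k" for k
    using arg_cong[OF G, of "\<lambda>H. H $$ k"] by simp
  have "p < 0"
  proof (rule ccontr)
    assume "\<not> p < 0"
    then have "q < 0" "p \<ge> 0" using pole by (auto simp: p_def q_def)
    then show False
      using eG[of "q - 1"] ab FF0[of "q - 1"] FG0[of "q - 1"] by (auto simp: b_def)
  qed
  have "\<not> q < p"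
    using eF[of "p + q"] FF0[of "p + q"] FGb F0[of "p + q + 1"] ab \<open>p < 0\<close> by auto
  moreover have "\<not> p < q"
    using eG[of "2 * p"] FG0[of "2 * p"] FFb G0[of "2 * p + 1"] ab nz \<open>p < 0\<close> by auto
  ultimately have "q = p" by simp
  have "p = -1"
  proof (rule ccontr)
    assume "p \<noteq> -1"
    then have p: "p < -1" using \<open>p < 0\<close> by simp
    have "a * a = a * b" "a * b = N * (a * a)"
      using eF[of "2 * p"] eG[of "2 * p"] F0[of "2 * p + 1"] G0[of "2 * p + 1"] FFb FGb p \<open>q = p\<close>
      by auto
    then have "b = a" "N = 1" using ab by auto
    then have "of_int p * a + of_int p * a = 0"
      using eF[of "p - 1"] eG[of "p - 1"] p \<open>q = p\<close> by (simp add: a_def b_def)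
    then show False using ab p by auto
  qed
  then show "fls_subdegree F = -1" "fls_subdegree G = -1"
    using \<open>q = p\<close> by (auto simp: p_def q_def)
qed

section \<open>Solutions with simple poles as power series\<close>

definition simple_pole :: "complex fps \<Rightarrow> complex fls" where
  "simple_pole f = fls_shift 1 (fps_to_fls f)"

lemma simple_pole_nth:
  fixes f :: "complex fps"
  shows "simple_pole f $$ (int r - 1) = f $ r"
  by (simp add: simple_pole_def)

lemma simple_pole_nth_lead: "simple_pole f $$ (-1) = f $ 0"
  using simple_pole_nth[of f 0] by simp

lemma simple_pole_eqI:
  assumes "fls_subdegree F = -1"
  obtains f where "F = simple_pole f"
proof
  show "F = simple_pole (fls_regpart (fls_shift (-1) F))"
    by (rule fls_eqI) (use assms in \<open>auto simp: simple_pole_def\<close>)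
qed

lemma fls_subdegree_simple_pole:
  fixes f :: "complex fps"
  assumes "f $ 0 \<noteq> 0"
  shows "simple_pole f \<noteq> 0" "fls_subdegree (simple_pole f) = -1"
proof -
  have nz: "simple_pole f $$ (-1) \<noteq> 0"
    using assms by (simp add: simple_pole_nth_lead)
  then show "simple_pole f \<noteq> 0" by auto
  show "fls_subdegree (simple_pole f) = -1"
    using nz by (rule fls_subdegree_eqI) (auto simp: simple_pole_def)
qed

lemma fls_conv_radius_simple_pole: "fls_conv_radius (simple_pole f) = fps_conv_radius f"
  by (simp add: simple_pole_def)

lemma simple_pole_mult: "simple_pole f * simple_pole g = fls_shift 2 (fps_to_fls (f * g))"
  by (simp add: simple_pole_def fls_times_fps_to_fls fls_times_both_shifted_simp)

text \<open>
  Coefficientwise, the system for \<open>f / \<tau>\<close> and \<open>g / \<tau>\<close> multiplied by \<open>\<tau>\<^sup>2\<close>. The left-hand sides are the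
  coefficients of \<open>\<tau> f' - f\<close> and \<open>\<tau> g' - g\<close>; the constant of the first equation lands at order \<open>2\<close>.
\<close>

definition bryant_series :: "complex \<Rightarrow> complex fps \<Rightarrow> complex fps \<Rightarrow> bool" where
  "bryant_series N f g \<longleftrightarrow>
     (\<forall>r. (of_nat r - 1) * f $ r = (f * f) $ r - (f * g) $ r + (if r = 2 then N - 1 else 0)) \<and>
     (\<forall>r. (of_nat r - 1) * g $ r = (f * g) $ r - N * (f * f) $ r)"

lemma simple_pole_deriv_eq_iff:
  fixes f h :: "complex fps"
  shows "fls_deriv (simple_pole f) = fls_shift 2 (fps_to_fls h) \<longleftrightarrow>
     (\<forall>r. (of_nat r - 1) * f $ r = h $ r)"
proof -
  have "fls_deriv (simple_pole f) = fls_shift 2 (fps_to_fls (fps_X * fps_deriv f - f))"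
  proof (rule fls_eqI)
    fix k
    show "fls_deriv (simple_pole f) $$ k = fls_shift 2 (fps_to_fls (fps_X * fps_deriv f - f)) $$ k"
    proof (cases "k \<ge> -2")
      case True
      then obtain r where k: "k = int r - 2" by (metis add_diff_cancel_right' diff_ge_0_iff_ge
          diff_minus_eq_add nonneg_int_cases)
      have "nat (1 + int m) = Suc m" for m by simp
      then show ?thesis unfolding k by (cases r) (auto simp: simple_pole_def algebra_simps)
    qed (auto simp: simple_pole_def)
  qed
  then have "fls_deriv (simple_pole f) = fls_shift 2 (fps_to_fls h) \<longleftrightarrow> fps_X * fps_deriv f - f = h"
    by (simp only: fls_shift_eq_iff fps_to_fls_eq_iff)
  also have "\<dots> \<longleftrightarrow> (\<forall>r. (of_nat r - 1) * f $ r = h $ r)"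
  proof -
    have "(fps_X * fps_deriv f - f) $ r = (of_nat r - 1) * f $ r" for r
      by (cases r) (auto simp: algebra_simps)
    then show ?thesis by (simp add: fps_eq_iff)
  qed
  finally show ?thesis .
qed

lemma bryant_series_iff:
  "bryant_series N f g \<longleftrightarrow>
     fls_deriv (simple_pole f) =
       simple_pole f * simple_pole f - simple_pole f * simple_pole g + fls_const (N - 1) \<and>
     fls_deriv (simple_pole g) =
       simple_pole f * simple_pole g - fls_const N * (simple_pole f * simple_pole f)"
proof -
  have c: "fls_const (N - 1) = fls_shift 2 (fps_to_fls (fps_const (N - 1) * fps_X ^ 2))"
    by (rule fls_eqI) auto
  have 1: "simple_pole f * simple_pole f - simple_pole f * simple_pole g + fls_const (N - 1)
      = fls_shift 2 (fps_to_fls (f * f - f * g + fps_const (N - 1) * fps_X ^ 2))"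
    unfolding simple_pole_mult c by (simp only: fps_to_fls_plus fps_to_fls_minus fls_shift_plus fls_shift_minus)
  have 2: "simple_pole f * simple_pole g - fls_const N * (simple_pole f * simple_pole f)
      = fls_shift 2 (fps_to_fls (f * g - fps_const N * (f * f)))"
    unfolding simple_pole_mult by (rule fls_eqI) (simp add: fls_times_fps_to_fls)
  show ?thesis
    unfolding bryant_series_def 1 2 simple_pole_deriv_eq_iff by auto
qed

section \<open>The coefficient recursion and its resonance\<close>

text \<open>
  The part of a Cauchy product that involves only coefficients of index strictly between \<open>0\<close> and
  \<open>r\<close>; splitting it off isolates the unknowns at order \<open>r\<close>.
\<close>

definition cauchy_inner :: "(nat \<Rightarrow> complex) \<Rightarrow> (nat \<Rightarrow> complex) \<Rightarrow> nat \<Rightarrow> complex" where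
  "cauchy_inner u v r = (\<Sum>i\<in>{0<..<r}. u i * v (r - i))"

lemma fps_mult_nth_split:
  fixes f g :: "complex fps"
  assumes "r > 0"
  shows "(f * g) $ r = f $ 0 * g $ r + f $ r * g $ 0 + cauchy_inner (fps_nth f) (fps_nth g) r"
proof -
  have "{0..r} = insert 0 (insert r {0<..<r})" using assms by auto
  then show ?thesis
    using assms by (simp add: fps_mult_nth cauchy_inner_def)
qed

text \<open>
  The right-hand sides of the linear equations at order \<open>r\<close>, contributed by the quadratic and
  constant terms of the system through coefficients already known.
\<close>

definition bryant_force_x where
  "bryant_force_x N u v r =
     cauchy_inner u u r - cauchy_inner u v r + (if r = 2 then N - 1 else 0)"

definition bryant_force_y where
  "bryant_force_y N u v r = cauchy_inner u v r - N * cauchy_inner u u r"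

text \<open>
  The order-zero equations \<open>- a = a\<^sup>2 - a b\<close> and \<open>- b = a b - N a\<^sup>2\<close> after eliminating \<open>b = a + 1\<close>.
\<close>

definition leading_solution :: "complex \<Rightarrow> complex \<Rightarrow> bool" where
  "leading_solution N a \<longleftrightarrow> a \<noteq> 0 \<and> N * (a * a) = (a + 1) * (a + 1)"

definition bryant_rows ::
  "complex \<Rightarrow> complex \<Rightarrow> (nat \<Rightarrow> complex) \<Rightarrow> (nat \<Rightarrow> complex) \<Rightarrow> nat \<Rightarrow> bool" where
  "bryant_rows N a u v r \<longleftrightarrow>
     (of_nat r - a) * u r + a * v r = bryant_force_x N u v r \<and>
     (2 * N * a - (a + 1)) * u r + (of_nat r - 1 - a) * v r = bryant_force_y N u v r"

lemma bryant_series_recurrence: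
  fixes f g :: "complex fps"
  assumes "f $ 0 \<noteq> 0"
  shows "bryant_series N f g \<longleftrightarrow>
     leading_solution N (f $ 0) \<and> g $ 0 = f $ 0 + 1 \<and>
     (\<forall>r>0. bryant_rows N (f $ 0) (fps_nth f) (fps_nth g) r)"
    (is "_ \<longleftrightarrow> ?L \<and> ?B \<and> (\<forall>r>0. ?E r)")
proof -
  define e where "e r \<longleftrightarrow>
     (of_nat r - 1) * f $ r = (f * f) $ r - (f * g) $ r + (if r = 2 then N - 1 else 0) \<and>
     (of_nat r - 1) * g $ r = (f * g) $ r - N * (f * f) $ r" for r
  have split: "bryant_series N f g \<longleftrightarrow> e 0 \<and> (\<forall>r>0. e r)"
    by (metis bryant_series_def e_def gr0I)
  have "e 0 \<longleftrightarrow> f $ 0 * (g $ 0 - (f $ 0 + 1)) = 0 \<and>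
        (f $ 0 + 1) * g $ 0 = N * (f $ 0 * f $ 0)"
    by (auto simp: e_def algebra_simps)
  then have e0: "e 0 \<longleftrightarrow> ?L \<and> ?B"
    using assms by (auto simp: leading_solution_def)
  have er: "e r \<longleftrightarrow> ?E r" if "r > 0" ?B for r
    unfolding e_def bryant_rows_def bryant_force_x_def bryant_force_y_def fps_mult_nth_split[OF \<open>r > 0\<close>] \<open>?B\<close>
    by (simp add: algebra_simps)
  show ?thesis
    using split e0 er by blast
qed

text \<open>
  The leading equation removes \<open>N\<close> and makes the determinant factor. The root \<open>-1\<close> is the
  one common to all autonomous systems, from the freedom to move \<open>t0\<close>.
\<close>

lemma bryant_determinant:
  assumes "leading_solution N a"
  shows "(s - a) * (s - 1 - a) - a * (2 * N * a - (a + 1)) = (s + 1) * (s - 2 - 2 * a)"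
proof -
  have "a * (2 * N * a - (a + 1)) = 2 * (N * (a * a)) - a * (a + 1)"
    by (simp add: algebra_simps)
  also have "\<dots> = 2 * ((a + 1) * (a + 1)) - a * (a + 1)"
    using assms by (simp add: leading_solution_def)
  finally show ?thesis by (simp add: algebra_simps)
qed

lemma bryant_determinant_nonzero:
  assumes "of_nat r \<noteq> 2 + 2 * (a :: complex)"
  shows "(of_nat r + 1) * (of_nat r - 2 - 2 * a) \<noteq> 0"
proof (rule no_zero_divisors)
  have "of_nat (Suc r) \<noteq> (0 :: complex)" by (rule of_nat_neq_0)
  then show "of_nat r + 1 \<noteq> (0 :: complex)" by (simp add: add.commute)
  show "of_nat r - 2 - 2 * a \<noteq> 0" using assms by (simp add: diff_diff_eq)
qed

lemma bryant_rows_cramer: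
  fixes N a p q P Q s :: complex
  assumes "leading_solution N a"
    and P: "(s - a) * p + a * q = P"
    and Q: "(2 * N * a - (a + 1)) * p + (s - 1 - a) * q = Q"
  shows "(s + 1) * (s - 2 - 2 * a) * p = (s - 1 - a) * P - a * Q"
    and "(s + 1) * (s - 2 - 2 * a) * q = (s - a) * Q - (2 * N * a - (a + 1)) * P"
  unfolding bryant_determinant[OF assms(1), symmetric] P[symmetric] Q[symmetric]
  by (simp_all add: algebra_simps)

lemma bryant_rows_solve:
  fixes N a p q P Q s :: complex
  assumes "leading_solution N a" and d: "d = (s + 1) * (s - 2 - 2 * a)" "d \<noteq> 0"
    and p: "p = ((s - 1 - a) * P - a * Q) / d"
    and q: "q = ((s - a) * Q - (2 * N * a - (a + 1)) * P) / d"
  shows "(s - a) * p + a * q = P"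
    and "(2 * N * a - (a + 1)) * p + (s - 1 - a) * q = Q"
proof -
  define m where "m = 2 * N * a - (a + 1)"
  have D: "(s - a) * (s - 1 - a) - a * m = d"
    using bryant_determinant[OF assms(1)] d by (simp add: m_def)
  have "(s - a) * p + a * q = ((s - a) * ((s - 1 - a) * P - a * Q) + a * ((s - a) * Q - m * P)) / d"
    by (simp add: p q m_def add_divide_distrib)
  also have "\<dots> = (d * P) / d"
    by (simp add: D[symmetric] algebra_simps)
  finally show "(s - a) * p + a * q = P" using d by simp
  have "m * p + (s - 1 - a) * q =
      (m * ((s - 1 - a) * P - a * Q) + (s - 1 - a) * ((s - a) * Q - m * P)) / d"
    by (simp add: p q m_def add_divide_distrib)
  also have "\<dots> = (d * Q) / d"
    by (simp add: D[symmetric] algebra_simps)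
  finally show "(2 * N * a - (a + 1)) * p + (s - 1 - a) * q = Q" using d by (simp add: m_def)
qed

lemma cauchy_inner_cong:
  assumes "\<And>i. i < r \<Longrightarrow> u i = u' i" "\<And>i. i < r \<Longrightarrow> v i = v' i"
  shows "cauchy_inner u v r = cauchy_inner u' v' r"
  unfolding cauchy_inner_def using assms by (intro sum.cong) auto

lemma bryant_force_cong:
  assumes "\<And>i. i < r \<Longrightarrow> u i = u' i" "\<And>i. i < r \<Longrightarrow> v i = v' i"
  shows "bryant_force_x N u v r = bryant_force_x N u' v' r"
    and "bryant_force_y N u v r = bryant_force_y N u' v' r"
  unfolding bryant_force_x_def bryant_force_y_def
  using cauchy_inner_cong[OF assms] cauchy_inner_cong[OF assms(1) assms(1)] by simp_all

text \<open>
  Away from the resonance the linear equations at order \<open>r\<close> are nonsingular; at the resonance the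
  coefficient of \<open>f\<close> is prescribed and the first equation still yields that of \<open>g\<close>, as its factor
  \<open>f $ 0\<close> is nonzero.
\<close>

lemma bryant_series_unique:
  fixes f g f' g' :: "complex fps"
  assumes sol: "bryant_series N f g" "bryant_series N f' g'"
    and lead: "f $ 0 \<noteq> 0" "f' $ 0 = f $ 0"
    and res: "\<And>r. r > 0 \<Longrightarrow> of_nat r = 2 + 2 * f $ 0 \<Longrightarrow> f $ r = f' $ r"
  shows "f = f' \<and> g = g'"
proof -
  define a where "a = f $ 0"
  note rec = bryant_series_recurrence[OF lead(1), of N g]
    bryant_series_recurrence[of f' N g', unfolded lead(2), OF lead(1)]
  have L: "leading_solution N a" and a0: "a \<noteq> 0"
    using rec sol lead by (auto simp: a_def)
  have "f $ r = f' $ r \<and> g $ r = g' $ r" for r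
  proof (induction r rule: less_induct)
    case (less r)
    show ?case
    proof (cases "r = 0")
      case True
      then show ?thesis using rec sol lead by simp
    next
      case False
      define s :: complex where "s = of_nat r"
      define P where "P = bryant_force_x N (fps_nth f) (fps_nth g) r"
      define Q where "Q = bryant_force_y N (fps_nth f) (fps_nth g) r"
      have rows: "(s - a) * f $ r + a * g $ r = P"
        "(2 * N * a - (a + 1)) * f $ r + (s - 1 - a) * g $ r = Q"
        using rec(1) sol(1) False by (auto simp: bryant_rows_def P_def Q_def a_def s_def)
      have PQ': "P = bryant_force_x N (fps_nth f') (fps_nth g') r"
        "Q = bryant_force_y N (fps_nth f') (fps_nth g') r"
        unfolding P_def Q_def by (rule bryant_force_cong; use less in auto)+
      have rows': "(s - a) * f' $ r + a * g' $ r = P"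
        "(2 * N * a - (a + 1)) * f' $ r + (s - 1 - a) * g' $ r = Q"
        unfolding PQ' using rec(2) sol(2) False by (auto simp: bryant_rows_def a_def s_def)
      show ?thesis
      proof (cases "s = 2 + 2 * a")
        case True
        then have "f $ r = f' $ r" using res False by (simp add: s_def a_def)
        then show ?thesis using rows(1) rows'(1) a0 by (metis add_left_cancel mult_left_cancel)
      next
        case nonres: False
        have d: "(s + 1) * (s - 2 - 2 * a) \<noteq> 0"
          using bryant_determinant_nonzero nonres unfolding s_def by blast
        show ?thesis
          using bryant_rows_cramer[OF L rows] bryant_rows_cramer[OF L rows'] d
          by (metis mult_left_cancel)
      qed
    qed
  qed
  then show ?thesis by (simp add: fps_eq_iff)
qed

text \<open>
  The formal solution with leading coefficients \<open>(a, a + 1)\<close>: Cramer's rule away from the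
  resonance, and at the resonance the free value \<open>c\<close> together with the second coefficient from the
  first equation. The sums repeat the forcing terms so that the recursive calls are visible to the
  termination proof.
\<close>

fun bryant_coeff :: "complex \<Rightarrow> complex \<Rightarrow> complex \<Rightarrow> nat \<Rightarrow> complex \<times> complex" where
  "bryant_coeff N a c r =
     (if r = 0 then (a, a + 1) else
      let s = of_nat r;
          xx = (\<Sum>i\<in>{0<..<r}. fst (bryant_coeff N a c i) * fst (bryant_coeff N a c (r - i)));
          xy = (\<Sum>i\<in>{0<..<r}. fst (bryant_coeff N a c i) * snd (bryant_coeff N a c (r - i)));
          P = xx - xy + (if r = 2 then N - 1 else 0);
          Q = xy - N * xx;
          d = (s + 1) * (s - 2 - 2 * a)
      in if s = 2 + 2 * a then (c, (P - (s - a) * c) / a)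
         else (((s - 1 - a) * P - a * Q) / d, ((s - a) * Q - (2 * N * a - (a + 1)) * P) / d))"

declare bryant_coeff.simps [simp del]

text \<open>
  A sufficient form of the compatibility condition at the resonance \<open>\<rho>\<close>: the whole right-hand side
  vanishes, so that the singular system at order \<open>\<rho>\<close> is homogeneous.
\<close>

definition resonance_compatible :: "complex \<Rightarrow> complex \<Rightarrow> nat \<Rightarrow> bool" where
  "resonance_compatible N a \<rho> \<longleftrightarrow>
     (\<forall>u v. u 0 = a \<longrightarrow> v 0 = a + 1 \<longrightarrow> (\<forall>r. 0 < r \<and> r < \<rho> \<longrightarrow> bryant_rows N a u v r) \<longrightarrow>
        bryant_force_x N u v \<rho> = 0 \<and> bryant_force_y N u v \<rho> = 0)"

lemma bryant_series_exists:
  assumes L: "leading_solution N a" and res: "of_nat \<rho> = 2 + 2 * a" "\<rho> > 0"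
    and compat: "resonance_compatible N a \<rho>"
  shows "\<exists>f g. bryant_series N f g \<and> f $ 0 = a \<and> g $ 0 = a + 1 \<and> f $ \<rho> = (c :: complex)"
proof -
  define u where "u r = fst (bryant_coeff N a c r)" for r
  define v where "v r = snd (bryant_coeff N a c r)" for r
  have a0: "a \<noteq> 0" using L by (simp add: leading_solution_def)
  have uv0: "u 0 = a" "v 0 = a + 1" by (simp_all add: u_def v_def bryant_coeff.simps)
  have uv: "(u r, v r) = (let s = of_nat r; P = bryant_force_x N u v r; Q = bryant_force_y N u v r;
          d = (s + 1) * (s - 2 - 2 * a)
      in if s = 2 + 2 * a then (c, (P - (s - a) * c) / a)
         else (((s - 1 - a) * P - a * Q) / d, ((s - a) * Q - (2 * N * a - (a + 1)) * P) / d))"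
    if "r > 0" for r
  proof -
    have "(u r, v r) = bryant_coeff N a c r" by (simp add: u_def v_def)
    then show ?thesis
      using that unfolding bryant_force_x_def bryant_force_y_def cauchy_inner_def u_def v_def
      by (subst (asm) (3) bryant_coeff.simps) (simp add: Let_def)
  qed
  let ?row = "bryant_rows N a u v"
  have row: "?row r" if "r > 0" "r \<noteq> \<rho>" for r
  proof -
    define s :: complex where "s = of_nat r"
    have "s \<noteq> 2 + 2 * a"
      using that res by (metis of_nat_eq_iff s_def)
    then have d: "(s + 1) * (s - 2 - 2 * a) \<noteq> 0"
      using bryant_determinant_nonzero unfolding s_def by blast
    show ?thesis
      unfolding bryant_rows_def s_def[symmetric]
      using bryant_rows_solve[OF L refl d] uv[OF \<open>r > 0\<close>] \<open>s \<noteq> 2 + 2 * a\<close>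
      by (simp add: Let_def s_def[symmetric])
  qed
  have force0: "bryant_force_x N u v \<rho> = 0" "bryant_force_y N u v \<rho> = 0"
    using compat uv0 row by (auto simp: resonance_compatible_def)
  have u\<rho>: "u \<rho> = c" "v \<rho> = - ((of_nat \<rho> - a) * c) / a"
    using uv[OF \<open>\<rho> > 0\<close>] force0 res by (auto simp: Let_def)
  have "?row \<rho>"
  proof -
    \<comment> \<open>Multiplied by \<open>a\<close>, the left-hand side of the second equation at \<open>\<rho>\<close> is \<open>- c\<close> times the determinant.\<close>
    have "a * ((2 * N * a - (a + 1)) * c + (of_nat \<rho> - 1 - a) * v \<rho>)
        = c * (a * (2 * N * a - (a + 1)) - (of_nat \<rho> - a) * (of_nat \<rho> - 1 - a))"
      using a0 by (simp add: u\<rho> field_simps)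
    also have "\<dots> = - c * ((of_nat \<rho> + 1) * (of_nat \<rho> - 2 - 2 * a))"
      unfolding bryant_determinant[OF L, symmetric] by (simp add: algebra_simps)
    also have "\<dots> = 0" by (simp add: res)
    finally have "(2 * N * a - (a + 1)) * c + (of_nat \<rho> - 1 - a) * v \<rho> = 0" using a0 by simp
    then show ?thesis using a0 by (simp add: bryant_rows_def force0 u\<rho>)
  qed
  then have rows: "?row r" if "r > 0" for r
    using row that by (cases "r = \<rho>") auto
  have "bryant_series N (Abs_fps u) (Abs_fps v)"
  proof (subst bryant_series_recurrence)
    show "Abs_fps u $ 0 \<noteq> 0" using a0 uv0 by simp
  qed (use rows L in \<open>simp add: uv0 Abs_fps_inverse\<close>)
  then show ?thesis using uv0 u\<rho> by (intro exI[of _ "Abs_fps u"] exI[of _ "Abs_fps v"]) auto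
qed

section \<open>Convergence of the formal solutions\<close>

text \<open>
  Try \<open>u i \<le> D R\<^bsup>i-1\<^esup>\<close> for \<open>i \<ge> 1\<close>. Every product in the convolution is then at most \<open>D\<^sup>2 R\<^bsup>r-2\<^esup>\<close>, and
  there are fewer than \<open>r\<close> of them, which the factor \<open>r\<close> on the left absorbs. What remains to be
  shown is \<open>C D\<^sup>2 R\<^bsup>r-2\<^esup> \<le> D R\<^bsup>r-1\<^esup>\<close>, and this holds once \<open>R \<ge> C D\<close>. The shifted exponent provides this
  spare factor \<open>R\<close>.
\<close>

lemma quadratic_majorant:
  fixes u :: "nat \<Rightarrow> real"
  assumes nonneg: "\<And>r. u r \<ge> 0" and "C \<ge> 0"
    and rec: "\<And>r. r > M \<Longrightarrow> real r * u r \<le> C * (\<Sum>i\<in>{0<..<r}. u i * u (r - i))"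
  shows "\<exists>D R. R > 0 \<and> (\<forall>r. u r \<le> D * R ^ r)"
proof -
  define D where "D = (\<Sum>i\<le>M. u i) + 1"
  define R where "R = C * D + 1"
  have D: "D \<ge> 1" using nonneg by (auto simp: D_def intro!: sum_nonneg)
  have R: "R \<ge> 1" using D \<open>C \<ge> 0\<close> by (simp add: R_def)
  have init: "u r \<le> D" if "r \<le> M" for r
    using member_le_sum[of r "{..M}" u] that nonneg by (auto simp: D_def)
  have bound: "u r \<le> D * R ^ (r - 1)" for r
  proof (induction r rule: less_induct)
    case (less r)
    show ?case
    proof (cases "r \<le> M")
      case True
      have "D * 1 \<le> D * R ^ (r - 1)" using D R by (intro mult_left_mono) auto
      then show ?thesis using init[OF True] by simp
    next
      case False
      have "(\<Sum>i\<in>{0<..<r}. u i * u (r - i)) \<le> (\<Sum>i\<in>{0<..<r}. D * D * R ^ (r - 2))"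
      proof (rule sum_mono)
        fix i assume i: "i \<in> {0<..<r}"
        have "u i * u (r - i) \<le> (D * R ^ (i - 1)) * (D * R ^ (r - i - 1))"
          using i less[of i] less[of "r - i"] nonneg D R by (intro mult_mono) auto
        also have "\<dots> = D * D * R ^ ((i - 1) + (r - i - 1))"
          by (simp add: power_add)
        also have "(i - 1) + (r - i - 1) = r - 2" using i by auto
        finally show "u i * u (r - i) \<le> D * D * R ^ (r - 2)" .
      qed
      also have "\<dots> \<le> real r * (D * D * R ^ (r - 2))"
        using D R by (auto intro!: mult_right_mono)
      finally have "real r * u r \<le> C * (real r * (D * D * R ^ (r - 2)))"
        using rec[of r] False \<open>C \<ge> 0\<close> by (meson mult_left_mono not_le order_trans)
      then have "real r * u r \<le> real r * (C * D * D * R ^ (r - 2))"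
        by (simp add: mult_ac)
      then have le: "u r \<le> C * D * D * R ^ (r - 2)"
        using False by (simp add: mult_le_cancel_left)
      show ?thesis
      proof (cases "r \<ge> 2")
        case True
        have "C * D * D * R ^ (r - 2) \<le> D * (R * R ^ (r - 2))"
          using D R by (simp add: R_def algebra_simps)
        also have "R * R ^ (r - 2) = R ^ (r - 1)"
          using True by (metis Suc_1 Suc_diff_Suc Suc_le_lessD power_Suc)
        finally show ?thesis using le by simp
      next
        case False
        \<comment> \<open>for \<open>r = 1\<close> the convolution is empty\<close>
        then have "r = 1" using \<open>\<not> r \<le> M\<close> by simp
        then have "u r \<le> 0" using rec[of r] \<open>\<not> r \<le> M\<close>
          by (simp flip: atLeastSucLessThan_greaterThanLessThan)
        also have "0 \<le> D * R ^ (r - 1)" using D R by simp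
        finally show ?thesis .
      qed
    qed
  qed
  have "u r \<le> D * R ^ r" for r
    using bound[of r] D R power_increasing[of "r - 1" r R] mult_left_mono[of "R ^ (r - 1)" "R ^ r" D]
    by linarith
  then show ?thesis using R by (intro exI[of _ D] exI[of _ R]) auto
qed

lemma fps_conv_radius_pos_if_geometric_bound:
  fixes f :: "complex fps"
  assumes "R > 0" and bound: "\<And>r. norm (f $ r) \<le> D * R ^ r"
  shows "fps_conv_radius f > 0"
proof -
  define z where "z = (of_real (1 / (2 * R)) :: complex)"
  have "summable (\<lambda>r. f $ r * z ^ r)"
  proof (rule summable_comparison_test')
    show "summable (\<lambda>r. D * (1 / 2) ^ r :: real)"
      by (intro summable_mult summable_geometric) auto
    fix r
    have "norm (f $ r * z ^ r) \<le> D * R ^ r * (1 / (2 * R)) ^ r"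
      using bound[of r] \<open>R > 0\<close>
      by (auto simp: norm_mult norm_power z_def norm_divide intro!: mult_right_mono)
    also have "\<dots> = D * (1 / 2) ^ r"
      using \<open>R > 0\<close> by (simp add: power_divide power_mult_distrib)
    finally show "norm (f $ r * z ^ r) \<le> D * (1 / 2) ^ r" .
  qed
  then have "fps_conv_radius f \<ge> norm z"
    unfolding fps_conv_radius_def by (rule conv_radius_geI)
  moreover have "ereal (norm z) > 0" using \<open>R > 0\<close> by (simp add: z_def)
  ultimately show ?thesis by (meson less_le_trans)
qed

lemma norm_cauchy_inner_le:
  "norm (cauchy_inner u v r) \<le>
     (\<Sum>i\<in>{0<..<r}. (norm (u i) + norm (v i)) * (norm (u (r - i)) + norm (v (r - i))))"
  "norm (cauchy_inner u u r) \<le>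
     (\<Sum>i\<in>{0<..<r}. (norm (u i) + norm (v i)) * (norm (u (r - i)) + norm (v (r - i))))"
  unfolding cauchy_inner_def
  by (intro order_trans[OF norm_sum] sum_mono, simp add: norm_mult mult_mono)+

text \<open>
  By Cramer's rule the coefficients at order \<open>r\<close> are bounded by cofactors of size \<open>O(r)\<close> times a
  convolution, divided by a determinant of size at least \<open>r\<^sup>2 / 2\<close> for large \<open>r\<close>. So the sum of the
  norms of the two coefficients satisfies the hypothesis of the majorant lemma.
\<close>

lemma bryant_series_converges:
  fixes f g :: "complex fps"
  assumes sol: "bryant_series N f g" and lead: "f $ 0 \<noteq> 0"
  shows "fps_conv_radius f > 0" "fps_conv_radius g > 0"
proof -
  define a where "a = f $ 0"
  define m where "m = 2 * N * a - (a + 1)"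
  define u where "u r = norm (f $ r) + norm (g $ r)" for r
  define K where "K = 2 + norm a + norm m"
  \<comment> \<open>Beyond \<open>M\<close>, \<open>r - 2 - 2 a\<close> has norm at least \<open>r / 2\<close> and the constant forcing at order \<open>2\<close> is past.\<close>
  define M where "M = nat \<lceil>2 * norm (2 + 2 * a)\<rceil> + 2"
  define C where "C = 4 * K * (3 + norm N)"
  note rec = bryant_series_recurrence[OF lead, of N g]
  have L: "leading_solution N a" using rec sol by (auto simp: a_def)
  have K: "K \<ge> 1" by (simp add: K_def)
  have ineq: "real r * u r \<le> C * (\<Sum>i\<in>{0<..<r}. u i * u (r - i))" if "r > M" for r
  proof -
    define s :: complex where "s = of_nat r"
    define P where "P = bryant_force_x N (fps_nth f) (fps_nth g) r"
    define Q where "Q = bryant_force_y N (fps_nth f) (fps_nth g) r"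
    define S where "S = (\<Sum>i\<in>{0<..<r}. u i * u (r - i))"
    have r: "r > 2" "real r \<ge> 2 * norm (2 + 2 * a)"
      using that unfolding M_def by linarith+
    have rows: "(s - a) * f $ r + a * g $ r = P" "m * f $ r + (s - 1 - a) * g $ r = Q"
      using rec sol r by (auto simp: bryant_rows_def P_def Q_def a_def s_def m_def)
    note cramer = bryant_rows_cramer[OF L rows(1) rows(2)[unfolded m_def], folded m_def]
    have inner: "norm (cauchy_inner (fps_nth f) (fps_nth g) r) \<le> S"
      "norm (cauchy_inner (fps_nth f) (fps_nth f) r) \<le> S"
      unfolding S_def u_def by (rule norm_cauchy_inner_le)+
    have P: "norm P \<le> 2 * S"
      using r inner norm_triangle_ineq4[of "cauchy_inner (fps_nth f) (fps_nth f) r"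
        "cauchy_inner (fps_nth f) (fps_nth g) r"]
      by (simp add: P_def bryant_force_x_def)
    have Q: "norm Q \<le> (1 + norm N) * S"
      using inner norm_triangle_ineq4[of "cauchy_inner (fps_nth f) (fps_nth g) r"
        "N * cauchy_inner (fps_nth f) (fps_nth f) r"]
        mult_left_mono[OF inner(2), of "norm N"]
      by (simp add: Q_def bryant_force_y_def norm_mult algebra_simps)
    have "real r > 2" using r by simp
    have s: "norm (s - 1 - a) \<le> real r * K" "norm (s - a) \<le> real r * K"
      "norm a \<le> real r * K" "norm m \<le> real r * K" 
    proof -
      have ge: "x \<le> real r * x" if "x \<ge> 0" for x :: real
        using r mult_right_mono[of 1 "real r" x] that by simp
      have "norm (s - 1 - a) \<le> norm s + 1 + norm a"
        using norm_triangle_ineq4[of "s - 1" a] norm_triangle_ineq4[of s 1] by simp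
      moreover have "norm (s - a) \<le> norm s + norm a" by (rule norm_triangle_ineq4)
      moreover have "norm s = real r" by (simp add: s_def)
      moreover have "real r * K = real r + real r + real r * norm a + real r * norm m"
        by (simp add: K_def algebra_simps)
      ultimately show "norm (s - 1 - a) \<le> real r * K" "norm (s - a) \<le> real r * K"
        "norm a \<le> real r * K" "norm m \<le> real r * K" 
        using ge[of "norm a"] ge[of "norm m"] norm_ge_zero[of a] norm_ge_zero[of m] \<open>real r > 2\<close>
        by linarith+
    qed
    define d where "d = (s + 1) * (s - 2 - 2 * a)"
    have "norm (x * y - z * w) \<le> real r * K * (norm y + norm w)"
      if "norm x \<le> real r * K" "norm z \<le> real r * K" for x y z w :: complex
      using that norm_triangle_ineq4[of "x * y" "z * w"]
        mult_right_mono[OF that(1), of "norm y"] mult_right_mono[OF that(2), of "norm w"]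
      by (simp add: norm_mult algebra_simps)
    then have "norm (d * f $ r) \<le> real r * K * (norm P + norm Q)"
      "norm (d * g $ r) \<le> real r * K * (norm Q + norm P)"
      unfolding d_def cramer using s by blast+
    then have "norm d * u r \<le> 2 * (real r * K * (norm P + norm Q))"
      by (simp add: u_def norm_mult algebra_simps)
    also have "\<dots> \<le> 2 * (real r * K * ((3 + norm N) * S))"
      using P Q K by (intro mult_left_mono) (auto simp: algebra_simps)
    finally have up: "norm d * u r \<le> 2 * (real r * K * ((3 + norm N) * S))" .
    have "real r * (real r / 2) \<le> norm (s + 1) * norm (s - (2 + 2 * a))"
    proof (rule mult_mono)
      have "s + 1 = of_nat (Suc r)" by (simp add: s_def)
      then show "real r \<le> norm (s + 1)" by (metis norm_of_nat of_nat_le_iff le_SucI order_refl)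
      show "real r / 2 \<le> norm (s - (2 + 2 * a))"
        using norm_triangle_ineq2[of s "2 + 2 * a"] r by (simp add: s_def)
    qed auto
    also have "\<dots> = norm d" by (simp add: d_def norm_mult diff_diff_eq)
    finally have "real r * (real r / 2) * u r \<le> norm d * u r"
      by (rule mult_right_mono) (simp add: u_def)
    then have "real r * (real r * u r) \<le> real r * (C * S)"
      using up by (simp add: C_def algebra_simps)
    then show ?thesis using r by (simp add: S_def)
  qed
  have "\<exists>D R. R > 0 \<and> (\<forall>r. u r \<le> D * R ^ r)"
    by (rule quadratic_majorant[OF _ _ ineq]) (use K in \<open>auto simp: u_def C_def\<close>)
  then obtain D R where R: "R > 0" "\<And>r. u r \<le> D * R ^ r" by blast
  show "fps_conv_radius f > 0"
    by (rule fps_conv_radius_pos_if_geometric_bound[OF R(1), of _ D])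
       (rule order_trans[OF _ R(2)], simp add: u_def)
  show "fps_conv_radius g > 0"
    by (rule fps_conv_radius_pos_if_geometric_bound[OF R(1), of _ D])
       (rule order_trans[OF _ R(2)], simp add: u_def)
qed


section \<open>Laurent families of the system\<close>

unbundle vec_syntax
\<comment> \<open>From here on \<open>$\<close> selects a component of a vector and \<open>$$\<close> a coefficient of a Laurent series.\<close>
unbundle no Formal_Power_Series.fps_syntax

text \<open>
  A Laurent series is determined by its sum near the centre and is differentiated termwise, so
  solving the differential equation in a punctured neighbourhood is an identity of Laurent series.
\<close>

lemma laurent_solution_iff_formal:
  fixes f :: "complex^'d \<Rightarrow> complex^'d" and X :: "(complex fls)^'d"
  assumes "\<And>i. fls_conv_radius (X $ i) > 0"
    and "\<And>i. (\<lambda>z. f (\<chi> j. eval_fls (X $ j) z) $ i) has_laurent_expansion R i"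
  shows "laurent_solution f t0 X \<longleftrightarrow> (\<forall>i. fls_deriv (X $ i) = R i)"
proof -
  have dX: "eval_fls (fls_deriv (X $ i)) has_laurent_expansion fls_deriv (X $ i)" for i
    using less_le_trans[OF assms(1) fls_conv_radius_deriv, of i]
    by (simp add: eval_fls_has_laurent_expansion)
  have punct: "\<forall>\<^sub>F z in at 0. z \<in> eball 0 (fls_conv_radius (X $ i)) - {0}" for i
    by (rule eventually_at_in_open) (use assms(1)[of i] in \<open>auto simp: zero_ereal_def\<close>)
  have der: "\<forall>\<^sub>F z in at 0. \<forall>D. ((\<lambda>s. eval_fls (X $ i) (s - t0)) has_field_derivative D)
      (at (z + t0)) \<longleftrightarrow> D = eval_fls (fls_deriv (X $ i)) z" for i
    using punct[of i]
  proof eventually_elim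
    case (elim z)
    have "((\<lambda>s. eval_fls (X $ i) (s - t0)) has_field_derivative eval_fls (fls_deriv (X $ i)) z)
        (at (z + t0))"
      using has_field_derivative_eval_fls[OF elim, of UNIV]
      by (subst DERIV_shift) simp
    then show ?case by (metis DERIV_unique)
  qed
  have "laurent_solution f t0 X \<longleftrightarrow> (\<forall>i. \<forall>\<^sub>F t in at t0.
      ((\<lambda>s. eval_fls (X $ i) (s - t0)) has_field_derivative
         f (\<chi> j. eval_fls (X $ j) (t - t0)) $ i) (at t))"
    using assms(1) eventually_ball_finite_distrib[of "UNIV :: 'd set"]
    by (simp add: laurent_solution_def)
  also have "\<dots> \<longleftrightarrow> (\<forall>i. \<forall>\<^sub>F z in at 0.
      ((\<lambda>s. eval_fls (X $ i) (s - t0)) has_field_derivative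
         f (\<chi> j. eval_fls (X $ j) z) $ i) (at (z + t0)))"
    by (subst at_to_0) (simp add: eventually_filtermap)
  also have "\<dots> \<longleftrightarrow> (\<forall>i. \<forall>\<^sub>F z in at 0.
      f (\<chi> j. eval_fls (X $ j) z) $ i = eval_fls (fls_deriv (X $ i)) z)"
    by (intro all_cong1 eventually_subst eventually_mono[OF der]) blast
  also have "\<dots> \<longleftrightarrow> (\<forall>i. fls_deriv (X $ i) = R i)"
  proof (intro all_cong1 iffI)
    fix i
    assume "\<forall>\<^sub>F z in at 0. f (\<chi> j. eval_fls (X $ j) z) $ i = eval_fls (fls_deriv (X $ i)) z"
    then have "eval_fls (fls_deriv (X $ i)) has_laurent_expansion R i"
      using assms(2)[of i] by (rule iffD1[OF has_laurent_expansion_cong[OF _ refl]])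
    then show "fls_deriv (X $ i) = R i"
      using dX[of i] has_laurent_expansion_unique by blast
  next
    fix i
    assume "fls_deriv (X $ i) = R i"
    then show "\<forall>\<^sub>F z in at 0. f (\<chi> j. eval_fls (X $ j) z) $ i = eval_fls (fls_deriv (X $ i)) z"
      using assms(2)[of i] by (auto simp: has_laurent_expansion_def elim!: eventually_mono)
  qed
  finally show ?thesis .
qed

lemma vector_2_eq_iff:
  fixes X :: "'a::zero^2"
  shows "X = vector [x, y] \<longleftrightarrow> X $ 1 = x \<and> X $ 2 = y"
  by (auto simp: vec_eq_iff forall_2)

lemma bryant_laurent_solution_iff:
  fixes X :: "(complex fls)^2"
  shows "laurent_solution (bryant_system n) t0 X \<longleftrightarrow>
    fls_conv_radius (X $ 1) > 0 \<and> fls_conv_radius (X $ 2) > 0 \<and>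
    fls_deriv (X $ 1) = X $ 1 * X $ 1 - X $ 1 * X $ 2 + fls_const (of_nat n - 1) \<and>
    fls_deriv (X $ 2) = X $ 1 * X $ 2 - fls_const (of_nat n) * (X $ 1 * X $ 1)"
proof (cases "fls_conv_radius (X $ 1) > 0 \<and> fls_conv_radius (X $ 2) > 0")
  case True
  let ?R = "vector [X $ 1 * X $ 1 - X $ 1 * X $ 2 + fls_const (of_nat n - 1),
                    X $ 1 * X $ 2 - fls_const (of_nat n) * (X $ 1 * X $ 1)] :: (complex fls)^2"
  have E: "eval_fls (X $ i) has_laurent_expansion X $ i" for i
    using True exhaust_2[of i] by (auto intro: eval_fls_has_laurent_expansion)
  have "laurent_solution (bryant_system n) t0 X \<longleftrightarrow> (\<forall>i. fls_deriv (X $ i) = ?R $ i)"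
  proof (rule laurent_solution_iff_formal)
    fix i :: 2
    show "fls_conv_radius (X $ i) > 0"
      using True exhaust_2[of i] by auto
    have sys: "bryant_system n (\<chi> j. eval_fls (X $ j) z) $ 1
        = eval_fls (X $ 1) z * eval_fls (X $ 1) z - eval_fls (X $ 1) z * eval_fls (X $ 2) z
          + (of_nat n - 1)"
      "bryant_system n (\<chi> j. eval_fls (X $ j) z) $ 2
        = eval_fls (X $ 1) z * eval_fls (X $ 2) z
          - of_nat n * (eval_fls (X $ 1) z * eval_fls (X $ 1) z)" for z
      by (simp_all add: bryant_system_def Let_def power2_eq_square)
    note mult = has_laurent_expansion_mult[OF E E]
    have "(\<lambda>z. bryant_system n (\<chi> j. eval_fls (X $ j) z) $ 1) has_laurent_expansion ?R $ 1"
      unfolding sys vector_2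
      by (rule has_laurent_expansion_add[OF has_laurent_expansion_diff[OF mult mult]
            has_laurent_expansion_const])
    moreover have
      "(\<lambda>z. bryant_system n (\<chi> j. eval_fls (X $ j) z) $ 2) has_laurent_expansion ?R $ 2"
      unfolding sys vector_2
      by (rule has_laurent_expansion_diff[OF mult has_laurent_expansion_cmult_left[OF mult]])
    ultimately show
      "(\<lambda>z. bryant_system n (\<chi> j. eval_fls (X $ j) z) $ i) has_laurent_expansion ?R $ i"
      using exhaust_2[of i] by auto
  qed
  then show ?thesis using True by (simp add: forall_2)
qed (auto simp: laurent_solution_def forall_2)

text \<open>
  Only the exponents \<open>(-1, -1)\<close> occur, and convergence is automatic, so that a family is
  parametrised by the formal power series solutions of the recursion.
\<close>

lemma bryant_laurent_family_iff:
  fixes X :: "(complex fls)^2"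
  assumes "n \<ge> 1" "\<exists>i. k i < 0"
  shows "X \<in> laurent_family (bryant_system n) t0 k A \<longleftrightarrow>
    k = (\<lambda>_. -1) \<and>
    (\<exists>f g. X = vector [simple_pole f, simple_pole g] \<and> bryant_series (of_nat n) f g \<and>
       fps_nth f 0 \<noteq> 0 \<and> fps_nth g 0 \<noteq> 0 \<and> vector [fps_nth f 0, fps_nth g 0] \<in> A)"
proof
  assume X: "X \<in> laurent_family (bryant_system n) t0 k A"
  then have sol: "laurent_solution (bryant_system n) t0 X"
    and nz: "X $ 1 \<noteq> 0" "X $ 2 \<noteq> 0"
    and k: "fls_subdegree (X $ 1) = k 1" "fls_subdegree (X $ 2) = k 2"
    and A: "(\<chi> i. fls_nth (X $ i) (k i)) \<in> A"
    by (auto simp: laurent_family_def)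
  note ode = sol[unfolded bryant_laurent_solution_iff]
  have "k 1 < 0 \<or> k 2 < 0" using assms(2) by (metis exhaust_2)
  then have k1: "fls_subdegree (X $ 1) = -1" "fls_subdegree (X $ 2) = -1"
    using leading_exponents[of "X $ 1" "X $ 2" "of_nat n"] ode nz k assms(1) by auto
  then have keq: "k = (\<lambda>_. -1)"
    using k by (intro ext) (metis exhaust_2)
  obtain f g where fg: "X $ 1 = simple_pole f" "X $ 2 = simple_pole g"
    using k1 by (metis simple_pole_eqI)
  then have "fps_nth f 0 \<noteq> 0" "fps_nth g 0 \<noteq> 0"
    using nz k1 nth_fls_subdegree_nonzero simple_pole_nth_lead by metis+
  moreover have "(\<chi> i. fls_nth (X $ i) (k i)) = vector [fps_nth f 0, fps_nth g 0]"
    by (simp add: vector_2_eq_iff keq fg simple_pole_nth_lead)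
  then have "vector [fps_nth f 0, fps_nth g 0] \<in> A" using A by simp
  moreover have "bryant_series (of_nat n) f g"
    using ode by (simp add: bryant_series_iff fg)
  moreover have "X = vector [simple_pole f, simple_pole g]"
    by (simp add: vector_2_eq_iff fg)
  ultimately show "k = (\<lambda>_. -1) \<and>
    (\<exists>f g. X = vector [simple_pole f, simple_pole g] \<and> bryant_series (of_nat n) f g \<and>
       fps_nth f 0 \<noteq> 0 \<and> fps_nth g 0 \<noteq> 0 \<and> vector [fps_nth f 0, fps_nth g 0] \<in> A)"
    using keq by blast
next
  assume "k = (\<lambda>_. -1) \<and>
    (\<exists>f g. X = vector [simple_pole f, simple_pole g] \<and> bryant_series (of_nat n) f g \<and>
       fps_nth f 0 \<noteq> 0 \<and> fps_nth g 0 \<noteq> 0 \<and> vector [fps_nth f 0, fps_nth g 0] \<in> A)"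
  then obtain f g where k: "k = (\<lambda>_. -1)" and X: "X = vector [simple_pole f, simple_pole g]"
    and sol: "bryant_series (of_nat n) f g"
    and nz: "fps_nth f 0 \<noteq> 0" "fps_nth g 0 \<noteq> 0" and A: "vector [fps_nth f 0, fps_nth g 0] \<in> A" by blast
  have "laurent_solution (bryant_system n) t0 X"
    using sol bryant_series_converges[OF sol nz(1)]
    unfolding bryant_laurent_solution_iff bryant_series_iff X vector_2 fls_conv_radius_simple_pole
    by blast
  moreover have order: "\<forall>i. X $ i \<noteq> 0 \<and> fls_subdegree (X $ i) = k i"
    using fls_subdegree_simple_pole[OF nz(1)] fls_subdegree_simple_pole[OF nz(2)]
    unfolding forall_2 X k vector_2 by blast
  moreover have fg_lead: "(\<chi> i. fls_nth (X $ i) (k i)) = vector [fps_nth f 0, fps_nth g 0]"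
    by (simp add: vec_eq_iff forall_2 k X simple_pole_nth_lead)
  ultimately show "X \<in> laurent_family (bryant_system n) t0 k A"
    using A order fg_lead by (simp only: laurent_family_def mem_Collect_eq simp_thms)
qed

section \<open>Which resonances occur\<close>

text \<open>
  With \<open>j = r - 2 = 2 a\<close> the leading equation reads \<open>n j\<^sup>2 = (j + 2)\<^sup>2\<close>, so \<open>j\<close> divides \<open>j + 2\<close> and hence
  \<open>2\<close>; moreover \<open>j \<ge> -1\<close> and \<open>j \<noteq> 0\<close>.
\<close>

lemma resonance_values:
  assumes "leading_solution (of_nat n) a" and "of_nat r = 2 + 2 * a" "r > 0"
  shows "n = 1 \<or> n = 4 \<or> n = 9"
proof -
  define j where "j = int r - 2"
  have j: "of_int j = 2 * a" using assms(2) by (simp add: j_def)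
  have a: "a \<noteq> 0" "of_nat n * (a * a) = (a + 1) * (a + 1)"
    using assms(1) by (auto simp: leading_solution_def)
  have "(of_int (int n * (j * j)) :: complex) = of_nat n * (a * a) * 4"
    by (simp add: j)
  also have "\<dots> = of_int ((j + 2) * (j + 2))"
    unfolding a(2) by (simp add: j algebra_simps)
  finally have eq: "int n * (j * j) = (j + 2) * (j + 2)"
    by (simp only: of_int_eq_iff)
  have "j \<noteq> 0" using a j by auto
  have "j ^ 2 dvd (j + 2) ^ 2"
    using eq by (metis dvd_triv_right power2_eq_square)
  then have "j dvd j + 2" by simp
  then have "j dvd 2" by simp
  then have "j \<le> 2" by (simp add: zdvd_imp_le)
  moreover have "j \<ge> -1" using assms(3) by (simp add: j_def)
  ultimately have "j = -1 \<or> j = 1 \<or> j = 2" using \<open>j \<noteq> 0\<close> by auto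
  then show ?thesis using eq by auto
qed

lemma finite_leading_solutions: "finite {a. leading_solution N a}"
proof -
  have "{a. leading_solution N a} \<subseteq> {a. poly [:-1, -2, N - 1:] a = 0}"
    by (auto simp: leading_solution_def algebra_simps)
  moreover have "[:-1, -2, N - 1:] \<noteq> 0" by simp
  ultimately show ?thesis using poly_roots_finite finite_subset by blast
qed

text \<open>
  Without a resonance a solution is determined by the leading coefficient of its first component,
  which is a root of a nonzero quadratic polynomial.
\<close>

lemma bryant_laurent_family_finite:
  assumes "n \<ge> 1" "\<not> (n = 1 \<or> n = 4 \<or> n = 9)" "\<exists>i. k i < 0"
  shows "finite (laurent_family (bryant_system n) t0 k A)"
proof (rule finite_imageD)
  let ?F = "laurent_family (bryant_system n) t0 k A"
  let ?h = "\<lambda>X :: (complex fls)^2. X $ 1 $$ (-1)"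
  have h: "?h (vector [simple_pole f, Y]) = fps_nth f 0" for f Y
    by (simp add: simple_pole_nth_lead)
  show "finite (?h ` ?F)"
  proof (rule finite_subset)
    show "?h ` ?F \<subseteq> {a. leading_solution (of_nat n) a}"
    proof (rule image_subsetI)
      fix X assume "X \<in> ?F"
      then obtain f g where X: "X = vector [simple_pole f, simple_pole g]"
        and sol: "bryant_series (of_nat n) f g" "fps_nth f 0 \<noteq> 0"
        using iffD1[OF bryant_laurent_family_iff[OF assms(1,3)]] by blast
      then show "?h X \<in> {a. leading_solution (of_nat n) a}"
        using bryant_series_recurrence[OF sol(2)] by (simp only: X h mem_Collect_eq)
    qed
  qed (rule finite_leading_solutions)
  show "inj_on ?h ?F"
  proof (rule inj_onI)
    fix X X' assume XX': "X \<in> ?F" "X' \<in> ?F" and eq: "?h X = ?h X'"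
    obtain f g where X: "X = vector [simple_pole f, simple_pole g]"
      and 1: "bryant_series (of_nat n) f g" "fps_nth f 0 \<noteq> 0"
      using iffD1[OF bryant_laurent_family_iff[OF assms(1,3)] XX'(1)] by blast
    obtain f' g' where X': "X' = vector [simple_pole f', simple_pole g']"
      and 2: "bryant_series (of_nat n) f' g'" "fps_nth f' 0 \<noteq> 0"
      using iffD1[OF bryant_laurent_family_iff[OF assms(1,3)] XX'(2)] by blast
    have lead: "leading_solution (of_nat n) (fps_nth f 0)"
      using bryant_series_recurrence[OF 1(2)] 1(1) by simp
    have "f = f' \<and> g = g'"
    proof (rule bryant_series_unique[OF 1(1) 2(1) 1(2)])
      show "fps_nth f' 0 = fps_nth f 0" using eq by (simp only: X X' h)
      show "fps_nth f r = fps_nth f' r" if "r > 0" "of_nat r = 2 + 2 * fps_nth f 0" for r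
        using resonance_values[OF lead that(2,1)] assms(2) by simp
    qed
    then show "X = X'" by (simp add: X X')
  qed
qed

section \<open>The strong Painleve test\<close>

text \<open>
  Since \<open>d - 1 = 1\<close>, there is a free coefficient besides \<open>t0\<close>, and it takes every nonzero value
  already at \<open>t0 = 0\<close>. So the family there is infinite.
\<close>

lemma strong_Painleve_test_imp_resonance:
  assumes "n \<ge> 1" "strong_Painleve_test (bryant_system n)"
  shows "n = 1 \<or> n = 4 \<or> n = 9"
proof (rule ccontr)
  assume n: "\<not> (n = 1 \<or> n = 4 \<or> n = 9)"
  obtain k A and P :: "(2 \<times> int) set" where kAP: "(\<exists>i. k i < 0) \<and>
        finite P \<and> card P = CARD(2) - 1 \<and> (\<forall>(i, m)\<in>P. k i \<le> m) \<and>
        (\<forall>t0 (v :: 2 \<times> int \<Rightarrow> complex).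
           (\<forall>(i, m)\<in>P. m = k i \<longrightarrow> v (i, m) \<noteq> 0) \<longrightarrow>
           (let S = {X \<in> laurent_family (bryant_system n) t0 k A.
                      \<forall>(i, m)\<in>P. fls_nth (X $ i) m = v (i, m)}
            in S \<noteq> {} \<and> finite S))"
    using assms(2) unfolding strong_Painleve_test_def by (elim exE) (rule that)
  note k = kAP[THEN conjunct1] and P = kAP[THEN conjunct2, THEN conjunct2, THEN conjunct1]
  have S: "\<exists>X. X \<in> laurent_family (bryant_system n) 0 k A \<and>
      (\<forall>(i, m)\<in>P. fls_nth (X $ i) m = c)" if "c \<noteq> 0" for c
    using kAP[THEN conjunct2, THEN conjunct2, THEN conjunct2, THEN conjunct2, rule_format,
        of "\<lambda>_. c" 0] that
    unfolding Let_def by blast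
  have "P \<noteq> {}" using P by auto
  then obtain i m where im: "(i, m) \<in> P" by auto
  have "UNIV - {0} \<subseteq> (\<lambda>X. fls_nth (X $ i) m) ` laurent_family (bryant_system n) 0 k A"
  proof
    fix c :: complex assume "c \<in> UNIV - {0}"
    then show "c \<in> (\<lambda>X. fls_nth (X $ i) m) ` laurent_family (bryant_system n) 0 k A"
      using S[of c] im by auto
  qed
  then have "finite (UNIV - {0 :: complex})"
    using bryant_laurent_family_finite[OF assms(1) n k] finite_subset by blast
  then show False using infinite_UNIV_char_0[where 'a = complex] by simp
qed

text \<open>
  The family is the branch with leading coefficients \<open>(a, a + 1)\<close>; the hypothesis \<open>a \<noteq> -1\<close> makes the
  second component have a pole as well. The free coefficient is that of \<open>\<tau>\<^bsup>\<rho>-1\<^esup>\<close> in the first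
  component, because of the shift by \<open>\<tau>\<close> between \<open>x\<close> and \<open>f\<close>. Each of its values belongs to exactly one
  solution.
\<close>

lemma strong_Painleve_test_if_compatible:
  assumes "n \<ge> 1" and L: "leading_solution (of_nat n) a"
    and res: "of_nat \<rho> = 2 + 2 * a" "\<rho> > 0"
    and "a \<noteq> -1"
    and compat: "resonance_compatible (of_nat n) a \<rho>"
  shows "strong_Painleve_test (bryant_system n)"
proof -
  let ?k = "\<lambda>_ :: 2. -1 :: int"
  let ?A = "{vector [a, a + 1]} :: (complex^2) set"
  let ?P = "{(1 :: 2, int \<rho> - 1)}"
  let ?S = "\<lambda>t0 c. {X \<in> laurent_family (bryant_system n) t0 ?k ?A. X $ 1 $$ (int \<rho> - 1) = c}"
  have a: "a \<noteq> 0" using L by (simp add: leading_solution_def)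
  have a1: "a + 1 \<noteq> 0" using \<open>a \<noteq> -1\<close> by (metis add_eq_0_iff2)
  have neg: "\<exists>i. ?k i < 0" by simp
  have fam: "X \<in> laurent_family (bryant_system n) t0 ?k ?A \<longleftrightarrow>
      (\<exists>f g. X = vector [simple_pole f, simple_pole g] \<and> bryant_series (of_nat n) f g \<and>
         fps_nth f 0 \<noteq> 0 \<and> fps_nth g 0 \<noteq> 0 \<and> vector [fps_nth f 0, fps_nth g 0] \<in> ?A)" for X t0
    using bryant_laurent_family_iff[OF \<open>n \<ge> 1\<close> neg, of X t0 ?A] by (simp only: simp_thms)
  have mem: "X \<in> ?S t0 c \<longleftrightarrow> (\<exists>f g. X = vector [simple_pole f, simple_pole g] \<and>
      bryant_series (of_nat n) f g \<and> fps_nth f 0 = a \<and> fps_nth g 0 = a + 1 \<and> fps_nth f \<rho> = c)" for X t0 c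
  proof
    assume "X \<in> ?S t0 c"
    then obtain f g where "X = vector [simple_pole f, simple_pole g]"
      "bryant_series (of_nat n) f g" "vector [fps_nth f 0, fps_nth g 0] \<in> ?A"
      "X $ 1 $$ (int \<rho> - 1) = c"
      using fam by blast
    then show "\<exists>f g. X = vector [simple_pole f, simple_pole g] \<and>
      bryant_series (of_nat n) f g \<and> fps_nth f 0 = a \<and> fps_nth g 0 = a + 1 \<and> fps_nth f \<rho> = c"
      by (intro exI[of _ f] exI[of _ g]) (simp add: vector_2_eq_iff simple_pole_nth)
  next
    assume "\<exists>f g. X = vector [simple_pole f, simple_pole g] \<and>
      bryant_series (of_nat n) f g \<and> fps_nth f 0 = a \<and> fps_nth g 0 = a + 1 \<and> fps_nth f \<rho> = c"
    then obtain f g where fg: "X = vector [simple_pole f, simple_pole g]"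
      "bryant_series (of_nat n) f g" "fps_nth f 0 = a" "fps_nth g 0 = a + 1" "fps_nth f \<rho> = c"
      by blast
    then have "X \<in> laurent_family (bryant_system n) t0 ?k ?A"
      unfolding fam by (intro exI[of _ f] exI[of _ g]) (simp add: a a1)
    moreover have "X $ 1 $$ (int \<rho> - 1) = c"
      by (simp add: fg(1,5) simple_pole_nth)
    ultimately show "X \<in> ?S t0 c" by simp
  qed
  have "?S t0 c \<noteq> {} \<and> finite (?S t0 c)" for t0 c
  proof -
    obtain f g where fg: "bryant_series (of_nat n) f g" "fps_nth f 0 = a" "fps_nth g 0 = a + 1" "fps_nth f \<rho> = c"
      using bryant_series_exists[OF L res compat, of c] by blast
    have "?S t0 c = {vector [simple_pole f, simple_pole g]}"
    proof (intro equalityI subsetI)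
      fix X assume "X \<in> ?S t0 c"
      then obtain f' g' where X: "X = vector [simple_pole f', simple_pole g']"
        and fg': "bryant_series (of_nat n) f' g'" "fps_nth f' 0 = a" "fps_nth f' \<rho> = c"
        unfolding mem by blast
      have "f = f' \<and> g = g'"
      proof (rule bryant_series_unique[OF fg(1) fg'(1)])
        show "fps_nth f r = fps_nth f' r" if "of_nat r = 2 + 2 * fps_nth f 0" for r
        proof -
          have "(of_nat r :: complex) = of_nat \<rho>" using that res fg by simp
          then show ?thesis using fg fg' by simp
        qed
      qed (use fg fg' a in auto)
      then show "X \<in> {vector [simple_pole f, simple_pole g]}" by (simp add: X)
    qed (use fg mem in blast)
    then show ?thesis by simp
  qed
  then show ?thesis
    unfolding strong_Painleve_test_def Let_def
    using res(2) by (intro exI[of _ ?k] exI[of _ ?A] exI[of _ ?P]) auto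
qed

lemma cauchy_inner_small:
  "cauchy_inner u v (Suc 0) = 0"
  "cauchy_inner u v 2 = u (Suc 0) * v (Suc 0)"
  "cauchy_inner u v 3 = u (Suc 0) * v 2 + u 2 * v (Suc 0)"
  "cauchy_inner u v 4 = u (Suc 0) * v 3 + u 2 * v 2 + u 3 * v (Suc 0)"
proof -
  have "{0<..<Suc 0} = {}" "{0<..<2} = {Suc 0}" "{0<..<3} = {Suc 0, 2}"
    "{0<..<4} = {Suc 0, 2, 3}" by auto
  then show "cauchy_inner u v (Suc 0) = 0"
    "cauchy_inner u v 2 = u (Suc 0) * v (Suc 0)"
    "cauchy_inner u v 3 = u (Suc 0) * v 2 + u 2 * v (Suc 0)"
    "cauchy_inner u v 4 = u (Suc 0) * v 3 + u 2 * v 2 + u 3 * v (Suc 0)"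
    by (simp_all add: cauchy_inner_def)
qed

lemmas low_order_simps =
  bryant_rows_def bryant_force_x_def bryant_force_y_def cauchy_inner_small

text \<open>
  For \<open>n = 1\<close> the resonance comes first and no convolution precedes it. For \<open>n = 9\<close> the coefficients
  at order \<open>1\<close> vanish, and every term of the convolutions at order \<open>3\<close> contains one of them. For
  \<open>n = 4\<close> the coefficients at order \<open>1\<close> and that of \<open>f\<close> at order \<open>2\<close> vanish; at order \<open>4\<close> the only
  products without an order-one factor are those of order-two coefficients, and each of them
  contains the vanishing one.
\<close>

lemma compatible_1: "resonance_compatible 1 (-1/2) 1"
  by (simp add: resonance_compatible_def low_order_simps)

lemma compatible_9: "resonance_compatible 9 (1/2) 3"
  unfolding resonance_compatible_def
proof (intro allI impI)
  fix u v :: "nat \<Rightarrow> complex"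
  assume rows: "\<forall>r. 0 < r \<and> r < 3 \<longrightarrow> bryant_rows 9 (1/2) u v r"
  have "bryant_rows 9 (1/2) u v (Suc 0)" using rows by simp
  then have "u (Suc 0) + v (Suc 0) = 0" "15 * u (Suc 0) - v (Suc 0) = 0"
    by (simp_all add: low_order_simps field_simps)
  then have "u (Suc 0) = 0" "v (Suc 0) = 0" by algebra+
  then show "bryant_force_x 9 u v 3 = 0 \<and> bryant_force_y 9 u v 3 = 0"
    by (simp add: low_order_simps)
qed

lemma compatible_4: "resonance_compatible 4 1 4"
  unfolding resonance_compatible_def
proof (intro allI impI)
  fix u v :: "nat \<Rightarrow> complex"
  assume rows: "\<forall>r. 0 < r \<and> r < 4 \<longrightarrow> bryant_rows 4 1 u v r"
  have "bryant_rows 4 1 u v (Suc 0)" using rows by simp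
  then have uv1: "u (Suc 0) = 0" "v (Suc 0) = 0"
    by (auto simp: low_order_simps)
  have "bryant_rows 4 1 u v 2" using rows by simp
  then have "u 2 = 0"
    by (simp add: low_order_simps uv1)
  then show "bryant_force_x 4 u v 4 = 0 \<and> bryant_force_y 4 u v 4 = 0"
    by (simp add: low_order_simps uv1)
qed

lemma strong_Painleve_test_bryant_1_4_9:
  "strong_Painleve_test (bryant_system 1)"
  "strong_Painleve_test (bryant_system 4)"
  "strong_Painleve_test (bryant_system 9)"
  using strong_Painleve_test_if_compatible[of 1 "-1/2" 1] compatible_1
    strong_Painleve_test_if_compatible[of 4 1 4] compatible_4
    strong_Painleve_test_if_compatible[of 9 "1/2" 3] compatible_9
  by (simp_all add: leading_solution_def)

theorem theorem2p2:
  fixes n :: nat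
  assumes "n \<ge> 1"
  shows "strong_Painleve_test (bryant_system n) \<longleftrightarrow> n = 1 \<or> n = 4 \<or> n = 9"
  using strong_Painleve_test_imp_resonance[OF assms] strong_Painleve_test_bryant_1_4_9 by blast

end
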